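(* Intuitionistic propositional logic $\mathsf{IPC}$ has both the propositional disjunctive interpolation property $\mathrm{PDIP}$ and its monotone version $\mathrm{mPDIP}$.
   Context: Formulas are over $\{\top,\bot,\wedge,\vee,\to\}$; $V(\phi)$ is the set of atoms of $\phi$; a formula is monotone if it contains no implication (negation $\neg\phi$ abbreviates $\phi\to\bot$). For a superintuitionistic logic $L$, an $L$-propositional disjunctive interpolant ($L$-PDI) for $(\phi\to\psi\vee\theta)\in L$ is a pair $(I,J)$ of formulas with $V(I),V(J)\subseteq V(\phi)$ such that $\phi\to(I\vee J)$, $I\to\psi$ and $J\to\theta$ are in $L$. An $L$-mPDI is an $L$-PDI where additionally $\phi$, $I$, $J$ are monotone. $L$ has PDIP if every $(\phi\to\psi\vee\theta)\in L$ has an $L$-PDI, and has mPDIP if every $(\phi\to\psi\vee\theta)\in L$ with $\phi$ monotone has an $L$-mPDI. *)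

theory Defs
  imports Main
begin

datatype (atoms: 'a) fm =
    Atom 'a
  | Top  (\<open>\<^bold>\<top>\<close>)
  | Bot  (\<open>\<^bold>\<bottom>\<close>)
  | Conj "'a fm" "'a fm"  (infixr \<open>\<^bold>\<and>\<close> 68)
  | Disj "'a fm" "'a fm"  (infixr \<open>\<^bold>\<or>\<close> 67)
  | Imp "'a fm" "'a fm"  (infixr \<open>\<^bold>\<rightarrow>\<close> 66)

primrec monotone_fm :: "'a fm \<Rightarrow> bool" where
  "monotone_fm (Atom p) \<longleftrightarrow> True"
| "monotone_fm \<^bold>\<top> \<longleftrightarrow> True"
| "monotone_fm \<^bold>\<bottom> \<longleftrightarrow> True"
| "monotone_fm (A \<^bold>\<and> B) \<longleftrightarrow> monotone_fm A \<and> monotone_fm B"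
| "monotone_fm (A \<^bold>\<or> B) \<longleftrightarrow> monotone_fm A \<and> monotone_fm B"
| "monotone_fm (A \<^bold>\<rightarrow> B) \<longleftrightarrow> False"

primrec subst_fm :: "('a \<Rightarrow> 'b fm) \<Rightarrow> 'a fm \<Rightarrow> 'b fm" where
  "subst_fm \<sigma> (Atom p) = \<sigma> p"
| "subst_fm \<sigma> \<^bold>\<top> = \<^bold>\<top>"
| "subst_fm \<sigma> \<^bold>\<bottom> = \<^bold>\<bottom>"
| "subst_fm \<sigma> (A \<^bold>\<and> B) = subst_fm \<sigma> A \<^bold>\<and> subst_fm \<sigma> B"
| "subst_fm \<sigma> (A \<^bold>\<or> B) = subst_fm \<sigma> A \<^bold>\<or> subst_fm \<sigma> B"
| "subst_fm \<sigma> (A \<^bold>\<rightarrow> B) = subst_fm \<sigma> A \<^bold>\<rightarrow> subst_fm \<sigma> B"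

text \<open>Intuitionistic propositional logic as the set of theorems of the standard Hilbert system:
  axiom schemes closed under modus ponens.\<close>

inductive_set IPC :: "'a fm set" where
  K: "A \<^bold>\<rightarrow> B \<^bold>\<rightarrow> A \<in> IPC"
| S: "(A \<^bold>\<rightarrow> B \<^bold>\<rightarrow> C) \<^bold>\<rightarrow> (A \<^bold>\<rightarrow> B) \<^bold>\<rightarrow> A \<^bold>\<rightarrow> C \<in> IPC"
| ConjE1: "A \<^bold>\<and> B \<^bold>\<rightarrow> A \<in> IPC"
| ConjE2: "A \<^bold>\<and> B \<^bold>\<rightarrow> B \<in> IPC"
| ConjI: "A \<^bold>\<rightarrow> B \<^bold>\<rightarrow> A \<^bold>\<and> B \<in> IPC"
| DisjI1: "A \<^bold>\<rightarrow> A \<^bold>\<or> B \<in> IPC"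
| DisjI2: "B \<^bold>\<rightarrow> A \<^bold>\<or> B \<in> IPC"
| DisjE: "(A \<^bold>\<rightarrow> C) \<^bold>\<rightarrow> (B \<^bold>\<rightarrow> C) \<^bold>\<rightarrow> A \<^bold>\<or> B \<^bold>\<rightarrow> C \<in> IPC"
| TopI: "\<^bold>\<top> \<in> IPC"
| BotE: "\<^bold>\<bottom> \<^bold>\<rightarrow> A \<in> IPC"
| MP: "A \<^bold>\<rightarrow> B \<in> IPC \<Longrightarrow> A \<in> IPC \<Longrightarrow> B \<in> IPC"

definition superintuitionistic :: "'a fm set \<Rightarrow> bool" where
  "superintuitionistic L \<longleftrightarrow>
     IPC \<subseteq> L \<and>
     (\<forall>A B. A \<^bold>\<rightarrow> B \<in> L \<longrightarrow> A \<in> L \<longrightarrow> B \<in> L) \<and>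
     (\<forall>\<sigma> A. A \<in> L \<longrightarrow> subst_fm \<sigma> A \<in> L)"

lemma IPC_subst: "A \<in> IPC \<Longrightarrow> subst_fm \<sigma> A \<in> IPC"
  by (induction rule: IPC.induct) (auto intro: IPC.intros)

lemma superintuitionistic_IPC: "superintuitionistic IPC"
  by (auto simp: superintuitionistic_def intro: IPC.MP IPC_subst)

text \<open>The following notions are meant for superintuitionistic \<open>L\<close>. The membership
  \<open>\<phi> \<^bold>\<rightarrow> \<psi> \<^bold>\<or> \<theta> \<in> L\<close> presupposed of an interpolated formula is a hypothesis in \<open>PDIP\<close> and
  \<open>mPDIP\<close>.\<close>

definition PDI :: "'a fm set \<Rightarrow> 'a fm \<Rightarrow> 'a fm \<Rightarrow> 'a fm \<Rightarrow> 'a fm \<times> 'a fm \<Rightarrow> bool" where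
  "PDI L \<phi> \<psi> \<theta> = (\<lambda>(I, J).
     atoms I \<subseteq> atoms \<phi> \<and> atoms J \<subseteq> atoms \<phi> \<and>
     \<phi> \<^bold>\<rightarrow> (I \<^bold>\<or> J) \<in> L \<and> I \<^bold>\<rightarrow> \<psi> \<in> L \<and> J \<^bold>\<rightarrow> \<theta> \<in> L)"

definition mPDI :: "'a fm set \<Rightarrow> 'a fm \<Rightarrow> 'a fm \<Rightarrow> 'a fm \<Rightarrow> 'a fm \<times> 'a fm \<Rightarrow> bool" where
  "mPDI L \<phi> \<psi> \<theta> = (\<lambda>(I, J).
     PDI L \<phi> \<psi> \<theta> (I, J) \<and> monotone_fm \<phi> \<and> monotone_fm I \<and> monotone_fm J)"

definition PDIP :: "'a fm set \<Rightarrow> bool" where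
  "PDIP L \<longleftrightarrow> (\<forall>\<phi> \<psi> \<theta>. \<phi> \<^bold>\<rightarrow> \<psi> \<^bold>\<or> \<theta> \<in> L \<longrightarrow> (\<exists>I J. PDI L \<phi> \<psi> \<theta> (I, J)))"

definition mPDIP :: "'a fm set \<Rightarrow> bool" where
  "mPDIP L \<longleftrightarrow>
     (\<forall>\<phi> \<psi> \<theta>. monotone_fm \<phi> \<longrightarrow> \<phi> \<^bold>\<rightarrow> \<psi> \<^bold>\<or> \<theta> \<in> L \<longrightarrow> (\<exists>I J. mPDI L \<phi> \<psi> \<theta> (I, J)))"

end

theory Submission
  imports Defs
begin

text \<open>
  A context \<open>\<Gamma>\<close> is simplified by replacing \<open>A \<^bold>\<and> B\<close> by \<open>A, B\<close>, branching on \<open>A \<^bold>\<or> B\<close>, and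
  replacing \<open>A \<^bold>\<rightarrow> B\<close> by \<open>B\<close> whenever \<open>\<Gamma>\<close> derives \<open>A\<close>. None of these steps introduces new atoms or
  implications. When no step applies, every member of \<open>\<Gamma>\<close> is slashed by \<open>\<Gamma>\<close> in the sense
  of Kleene and Aczel; hence \<open>\<Gamma>\<close> has the disjunction property and
  the conjunction of \<open>\<Gamma>\<close>, paired with \<open>\<^bold>\<bottom>\<close>, is an interpolant. The branches are glued together by
  disjunction.
\<close>

text \<open>Modus ponens is the only rule besides hypotheses and theorems, so the deduction theorem
  rests on the axioms \<open>K\<close> and \<open>S\<close>.\<close>

inductive derives :: "'a fm set \<Rightarrow> 'a fm \<Rightarrow> bool" (infix \<open>\<tturnstile>\<close> 50) for \<Gamma> where
  Hyp: "A \<in> \<Gamma> \<Longrightarrow> \<Gamma> \<tturnstile> A"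
| Thm: "A \<in> IPC \<Longrightarrow> \<Gamma> \<tturnstile> A"
| MP: "\<Gamma> \<tturnstile> A \<^bold>\<rightarrow> B \<Longrightarrow> \<Gamma> \<tturnstile> A \<Longrightarrow> \<Gamma> \<tturnstile> B"

lemma derives_cut:
  assumes "\<Delta> \<tturnstile> A" "\<And>D. D \<in> \<Delta> \<Longrightarrow> \<Gamma> \<tturnstile> D"
  shows "\<Gamma> \<tturnstile> A"
  using assms by (induction rule: derives.induct) (auto intro: derives.intros)

lemma derives_mono: "\<Delta> \<tturnstile> A \<Longrightarrow> \<Delta> \<subseteq> \<Gamma> \<Longrightarrow> \<Gamma> \<tturnstile> A"
  by (erule derives_cut) (auto intro: derives.Hyp)

lemma derives_ImpI:
  assumes "insert A \<Gamma> \<tturnstile> B"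
  shows "\<Gamma> \<tturnstile> A \<^bold>\<rightarrow> B"
  using assms
proof (induction rule: derives.induct)
  case (Hyp B)
  have "A \<^bold>\<rightarrow> A \<in> IPC"
    using IPC.S[of A "A \<^bold>\<rightarrow> A" A] IPC.K IPC.MP by blast
  then show ?case
    using Hyp by (auto intro: derives.intros IPC.K)
next
  case (Thm B)
  then show ?case by (auto intro: derives.intros IPC.intros)
next
  case (MP B C)
  then show ?case by (meson derives.Thm derives.MP IPC.S)
qed

lemma derives_empty_iff: "{} \<tturnstile> A \<longleftrightarrow> A \<in> IPC"
proof
  show "{} \<tturnstile> A \<Longrightarrow> A \<in> IPC"
    by (induction rule: derives.induct) (auto intro: IPC.MP)
qed (rule derives.Thm)

lemma derives_Imp_iff: "\<Gamma> \<tturnstile> A \<^bold>\<rightarrow> B \<longleftrightarrow> insert A \<Gamma> \<tturnstile> B"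
  by (meson derives_ImpI derives_mono derives.Hyp derives.MP insertI1 subset_insertI)

lemma Imp_IPC_iff: "A \<^bold>\<rightarrow> B \<in> IPC \<longleftrightarrow> {A} \<tturnstile> B"
  using derives_Imp_iff[of "{}"] by (simp add: derives_empty_iff)

lemma derives_Top: "\<Gamma> \<tturnstile> \<^bold>\<top>"
  by (intro derives.Thm IPC.TopI)

lemma derives_BotE: "\<Gamma> \<tturnstile> \<^bold>\<bottom> \<Longrightarrow> \<Gamma> \<tturnstile> A"
  by (meson derives.Thm derives.MP IPC.BotE)

lemma derives_ConjI: "\<Gamma> \<tturnstile> A \<Longrightarrow> \<Gamma> \<tturnstile> B \<Longrightarrow> \<Gamma> \<tturnstile> A \<^bold>\<and> B"
  by (meson derives.Thm derives.MP IPC.ConjI)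

lemma derives_ConjE1: "\<Gamma> \<tturnstile> A \<^bold>\<and> B \<Longrightarrow> \<Gamma> \<tturnstile> A"
  by (meson derives.Thm derives.MP IPC.ConjE1)

lemma derives_ConjE2: "\<Gamma> \<tturnstile> A \<^bold>\<and> B \<Longrightarrow> \<Gamma> \<tturnstile> B"
  by (meson derives.Thm derives.MP IPC.ConjE2)

lemma derives_DisjI1: "\<Gamma> \<tturnstile> A \<Longrightarrow> \<Gamma> \<tturnstile> A \<^bold>\<or> B"
  by (meson derives.Thm derives.MP IPC.DisjI1)

lemma derives_DisjI2: "\<Gamma> \<tturnstile> B \<Longrightarrow> \<Gamma> \<tturnstile> A \<^bold>\<or> B"
  by (meson derives.Thm derives.MP IPC.DisjI2)

lemma derives_DisjE:
  "\<Gamma> \<tturnstile> A \<^bold>\<or> B \<Longrightarrow> insert A \<Gamma> \<tturnstile> C \<Longrightarrow> insert B \<Gamma> \<tturnstile> C \<Longrightarrow> \<Gamma> \<tturnstile> C"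
  by (meson derives_ImpI derives.Thm derives.MP IPC.DisjE)

lemma derives_foldr_Conj: "(\<And>A. A \<in> set As \<Longrightarrow> \<Gamma> \<tturnstile> A) \<Longrightarrow> \<Gamma> \<tturnstile> foldr Conj As \<^bold>\<top>"
  by (induction As) (auto intro: derives_Top derives_ConjI)

lemma foldr_Conj_derives: "\<Gamma> \<tturnstile> foldr Conj As \<^bold>\<top> \<Longrightarrow> A \<in> set As \<Longrightarrow> \<Gamma> \<tturnstile> A"
  by (induction As) (auto dest: derives_ConjE1 derives_ConjE2)

text \<open>Aczel's form of the slash: only the implication clause carries an extra derivability
  conjunct, which is enough for \<open>slash_derives\<close>. The clause for \<open>Bot\<close>
  admits inconsistent contexts.\<close>

primrec slash :: "'a fm set \<Rightarrow> 'a fm \<Rightarrow> bool" where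
  "slash \<Gamma> (Atom p) \<longleftrightarrow> \<Gamma> \<tturnstile> Atom p"
| "slash \<Gamma> \<^bold>\<top> \<longleftrightarrow> True"
| "slash \<Gamma> \<^bold>\<bottom> \<longleftrightarrow> \<Gamma> \<tturnstile> \<^bold>\<bottom>"
| "slash \<Gamma> (A \<^bold>\<and> B) \<longleftrightarrow> slash \<Gamma> A \<and> slash \<Gamma> B"
| "slash \<Gamma> (A \<^bold>\<or> B) \<longleftrightarrow> slash \<Gamma> A \<or> slash \<Gamma> B"
| "slash \<Gamma> (A \<^bold>\<rightarrow> B) \<longleftrightarrow> \<Gamma> \<tturnstile> A \<^bold>\<rightarrow> B \<and> (slash \<Gamma> A \<longrightarrow> slash \<Gamma> B)"

lemma slash_derives: "slash \<Gamma> A \<Longrightarrow> \<Gamma> \<tturnstile> A"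
  by (induction A) (auto intro: derives_Top derives_ConjI derives_DisjI1 derives_DisjI2)

text \<open>Settles the axiom \<open>BotE\<close> in \<open>slash_IPC\<close>, since a slashed
  \<open>Bot\<close> only says that \<open>\<Gamma>\<close> derives \<open>Bot\<close>.\<close>

lemma slash_if_derives_Bot: "\<Gamma> \<tturnstile> \<^bold>\<bottom> \<Longrightarrow> slash \<Gamma> A"
  by (induction A) (auto intro: derives_BotE)

text \<open>Modus ponens is built into the implication clause. Apart from derivability the clauses
  are truth-functional, and all axioms but \<open>BotE\<close> are tautologies whatever
  \<open>Bot\<close> means; what remains is to derive the partial applications of each
  axiom.\<close>

lemma slash_IPC:
  assumes "A \<in> IPC"
  shows "slash \<Gamma> A"
  using assms
proof (induction rule: IPC.induct)
  case (K A B)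
  then show ?case
    by (auto intro: derives.Thm derives.MP IPC.K slash_derives)
next
  case (S A B C)
  have S: "\<Gamma> \<tturnstile> (A \<^bold>\<rightarrow> B \<^bold>\<rightarrow> C) \<^bold>\<rightarrow> (A \<^bold>\<rightarrow> B) \<^bold>\<rightarrow> A \<^bold>\<rightarrow> C"
    by (intro derives.Thm IPC.S)
  then show ?case
    \<comment> \<open>Each nested implication demands its own derivation: the axiom is applied to
      one, then two slashed antecedents, which are implications and hence derivable.\<close>
    using derives.MP[OF S] derives.MP[OF derives.MP[OF S]] by auto
next
  case (ConjI A B)
  then show ?case
    by (auto intro: derives.Thm derives.MP IPC.ConjI slash_derives)
next
  case (DisjE A C B)
  have D: "\<Gamma> \<tturnstile> (A \<^bold>\<rightarrow> C) \<^bold>\<rightarrow> (B \<^bold>\<rightarrow> C) \<^bold>\<rightarrow> A \<^bold>\<or> B \<^bold>\<rightarrow> C"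
    by (intro derives.Thm IPC.DisjE)
  then show ?case
    using derives.MP[OF D] derives.MP[OF derives.MP[OF D]] by auto
qed (auto intro: derives.Thm IPC.intros slash_if_derives_Bot)

lemma derives_slash:
  assumes "\<Gamma> \<tturnstile> A" "\<And>B. B \<in> \<Gamma> \<Longrightarrow> slash \<Gamma> B"
  shows "slash \<Gamma> A"
  using assms by (induction rule: derives.induct) (auto intro: slash_IPC)

lemma disjunction_property:
  assumes "\<Gamma> \<tturnstile> A \<^bold>\<or> B" "\<And>C. C \<in> \<Gamma> \<Longrightarrow> slash \<Gamma> C"
  shows "\<Gamma> \<tturnstile> A \<or> \<Gamma> \<tturnstile> B"
  using derives_slash[OF assms] by (auto intro: slash_derives)

text \<open>Monotonicity is conditional so that one induction yields both properties. With a list,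
  the effect of replacing one occurrence on the sum of sizes is a direct computation.\<close>

definition interpolates :: "'a fm list \<Rightarrow> 'a fm \<Rightarrow> 'a fm \<Rightarrow> 'a fm \<Rightarrow> 'a fm \<Rightarrow> bool" where
  "interpolates \<Gamma> \<psi> \<theta> I J \<longleftrightarrow>
     atoms I \<union> atoms J \<subseteq> \<Union> (atoms ` set \<Gamma>) \<and>
     ((\<forall>A \<in> set \<Gamma>. monotone_fm A) \<longrightarrow> monotone_fm I \<and> monotone_fm J) \<and>
     set \<Gamma> \<tturnstile> I \<^bold>\<or> J \<and> {I} \<tturnstile> \<psi> \<and> {J} \<tturnstile> \<theta>"

text \<open>Carries an interpolant back along a simplification step whose result follows from the
  original context, as in the conjunction and implication cases.\<close>

lemma interpolates_cut:
  assumes "interpolates \<Delta> \<psi> \<theta> I J"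
    and "\<And>D. D \<in> set \<Delta> \<Longrightarrow> set \<Gamma> \<tturnstile> D"
    and "\<Union> (atoms ` set \<Delta>) \<subseteq> \<Union> (atoms ` set \<Gamma>)"
    and "\<forall>A \<in> set \<Gamma>. monotone_fm A \<Longrightarrow> \<forall>A \<in> set \<Delta>. monotone_fm A"
  shows "interpolates \<Gamma> \<psi> \<theta> I J"
  using assms derives_cut[of "set \<Delta>" "I \<^bold>\<or> J" "set \<Gamma>"] unfolding interpolates_def by blast

text \<open>A branch need not follow from the disjunctive context, so
  \<open>interpolates_cut\<close> gives way to a case analysis, with the pairs joined
  componentwise.\<close>

lemma interpolates_Disj:
  assumes 1: "interpolates (xs @ A # ys) \<psi> \<theta> I\<^sub>1 J\<^sub>1"
    and 2: "interpolates (xs @ B # ys) \<psi> \<theta> I\<^sub>2 J\<^sub>2"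
  shows "interpolates (xs @ (A \<^bold>\<or> B) # ys) \<psi> \<theta> (I\<^sub>1 \<^bold>\<or> I\<^sub>2) (J\<^sub>1 \<^bold>\<or> J\<^sub>2)"
proof -
  let ?\<Gamma> = "set (xs @ (A \<^bold>\<or> B) # ys)" and ?K = "(I\<^sub>1 \<^bold>\<or> I\<^sub>2) \<^bold>\<or> (J\<^sub>1 \<^bold>\<or> J\<^sub>2)"
  have "insert A ?\<Gamma> \<tturnstile> I\<^sub>1 \<^bold>\<or> J\<^sub>1"
    using 1 by (auto simp: interpolates_def intro: derives_mono)
  then have "insert A ?\<Gamma> \<tturnstile> ?K"
    by (rule derives_DisjE) (auto intro: derives_DisjI1 derives_DisjI2 derives.Hyp)
  moreover have "insert B ?\<Gamma> \<tturnstile> I\<^sub>2 \<^bold>\<or> J\<^sub>2"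
    using 2 by (auto simp: interpolates_def intro: derives_mono)
  then have "insert B ?\<Gamma> \<tturnstile> ?K"
    by (rule derives_DisjE) (auto intro: derives_DisjI1 derives_DisjI2 derives.Hyp)
  moreover have "?\<Gamma> \<tturnstile> A \<^bold>\<or> B"
    by (auto intro: derives.Hyp)
  ultimately have "?\<Gamma> \<tturnstile> ?K"
    by (blast intro: derives_DisjE)
  \<comment> \<open>Applied with \<open>\<psi>\<close> to the first components and with
    \<open>\<theta>\<close> to the second ones.\<close>
  moreover have "{C \<^bold>\<or> D} \<tturnstile> \<chi>" if "{C} \<tturnstile> \<chi>" "{D} \<tturnstile> \<chi>" for C D \<chi> :: "'a fm"
    by (rule derives_DisjE[of _ C D]) (auto intro: derives.Hyp derives_mono that)
  ultimately show ?thesis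
    using 1 2 by (auto simp: interpolates_def)
qed

lemma interpolates_left:
  assumes "set \<Gamma> \<tturnstile> \<psi>"
  shows "interpolates \<Gamma> \<psi> \<theta> (foldr Conj \<Gamma> \<^bold>\<top>) \<^bold>\<bottom>"
proof -
  have "{foldr Conj \<Gamma> \<^bold>\<top>} \<tturnstile> \<psi>"
    using assms by (rule derives_cut) (auto intro: foldr_Conj_derives derives.Hyp)
  moreover have "atoms (foldr Conj \<Gamma> \<^bold>\<top>) \<subseteq> \<Union> (atoms ` set \<Gamma>)"
    by (induction \<Gamma>) auto
  moreover have "(\<forall>A \<in> set \<Gamma>. monotone_fm A) \<longrightarrow> monotone_fm (foldr Conj \<Gamma> \<^bold>\<top>)"
    by (induction \<Gamma>) auto
  ultimately show ?thesis
    by (auto simp: interpolates_def intro: derives_DisjI1 derives_foldr_Conj derives_BotE derives.Hyp)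
qed

lemma interpolates_swap: "interpolates \<Gamma> \<psi> \<theta> I J \<Longrightarrow> interpolates \<Gamma> \<theta> \<psi> J I"
  using derives_DisjE[of "set \<Gamma>" I J "J \<^bold>\<or> I"]
  by (simp add: interpolates_def derives_DisjI1 derives_DisjI2 derives.Hyp Un_commute)

text \<open>A binary connective adds one to the sizes of its parts, so even the conjunction step,
  which keeps both parts, decreases the measure.\<close>

lemma ex_interpolates:
  assumes "set \<Gamma> \<tturnstile> \<psi> \<^bold>\<or> \<theta>"
  shows "\<exists>I J. interpolates \<Gamma> \<psi> \<theta> I J"
  using assms
proof (induction "sum_list (map size \<Gamma>)" arbitrary: \<Gamma> rule: less_induct)
  case less
  consider (conj) A B where "A \<^bold>\<and> B \<in> set \<Gamma>"
    | (disj) A B where "A \<^bold>\<or> B \<in> set \<Gamma>"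
    | (imp) A B where "A \<^bold>\<rightarrow> B \<in> set \<Gamma>" "set \<Gamma> \<tturnstile> A"
    | (irreducible) "\<And>A B. A \<^bold>\<and> B \<notin> set \<Gamma>" "\<And>A B. A \<^bold>\<or> B \<notin> set \<Gamma>"
        "\<And>A B. A \<^bold>\<rightarrow> B \<in> set \<Gamma> \<Longrightarrow> \<not> set \<Gamma> \<tturnstile> A"
    by blast
  then show ?case
  proof cases
    case conj
    then obtain xs ys where \<Gamma>: "\<Gamma> = xs @ (A \<^bold>\<and> B) # ys"
      by (auto dest: split_list)
    let ?\<Delta> = "xs @ A # B # ys"
    have "set ?\<Delta> \<tturnstile> \<psi> \<^bold>\<or> \<theta>"
      using less.prems by (rule derives_cut) (auto simp: \<Gamma> intro: derives.Hyp derives_ConjI)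
    then obtain I J where "interpolates ?\<Delta> \<psi> \<theta> I J"
      using less.hyps[of ?\<Delta>] by (auto simp: \<Gamma>)
    moreover have "set \<Gamma> \<tturnstile> A" "set \<Gamma> \<tturnstile> B"
      using conj by (auto intro: derives_ConjE1 derives_ConjE2 derives.Hyp)
    ultimately have "interpolates \<Gamma> \<psi> \<theta> I J"
      by (elim interpolates_cut) (auto simp: \<Gamma> intro: derives.Hyp)
    then show ?thesis by blast
  next
    case disj
    then obtain xs ys where \<Gamma>: "\<Gamma> = xs @ (A \<^bold>\<or> B) # ys"
      by (auto dest: split_list)
    have "set (xs @ A # ys) \<tturnstile> \<psi> \<^bold>\<or> \<theta>"
      using less.prems by (rule derives_cut) (auto simp: \<Gamma> intro: derives.Hyp derives_DisjI1)
    moreover have "set (xs @ B # ys) \<tturnstile> \<psi> \<^bold>\<or> \<theta>"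
      using less.prems by (rule derives_cut) (auto simp: \<Gamma> intro: derives.Hyp derives_DisjI2)
    ultimately show ?thesis
      using less.hyps[of "xs @ A # ys"] less.hyps[of "xs @ B # ys"] interpolates_Disj
      unfolding \<Gamma> by fastforce
  next
    case imp
    then obtain xs ys where \<Gamma>: "\<Gamma> = xs @ (A \<^bold>\<rightarrow> B) # ys"
      by (auto dest: split_list)
    let ?\<Delta> = "xs @ B # ys"
    \<comment> \<open>\<open>B\<close> yields the implication that it replaces, so the premise
      passes to the new context; that \<open>\<Gamma>\<close> derives \<open>A\<close> serves the
      way back to \<open>\<Gamma>\<close>.\<close>
    have "set ?\<Delta> \<tturnstile> A \<^bold>\<rightarrow> B"
      by (auto intro: derives_ImpI derives.Hyp)
    then have "set ?\<Delta> \<tturnstile> \<psi> \<^bold>\<or> \<theta>"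
      using less.prems by (elim derives_cut) (auto simp: \<Gamma> intro: derives.Hyp)
    then obtain I J where "interpolates ?\<Delta> \<psi> \<theta> I J"
      using less.hyps[of ?\<Delta>] by (auto simp: \<Gamma>)
    moreover have "set \<Gamma> \<tturnstile> B"
      using imp by (auto intro: derives.MP derives.Hyp)
    ultimately have "interpolates \<Gamma> \<psi> \<theta> I J"
      by (elim interpolates_cut) (auto simp: \<Gamma> intro: derives.Hyp)
    then show ?thesis by blast
  next
    case irreducible
    \<comment> \<open>For an implication the antecedent is not derivable, hence by
      \<open>slash_derives\<close> not slashed, and the clause holds vacuously.\<close>
    have "slash (set \<Gamma>) C" if "C \<in> set \<Gamma>" for C
      by (cases C; use that irreducible in \<open>auto intro: derives.Hyp dest: slash_derives\<close>)
    then have "set \<Gamma> \<tturnstile> \<psi> \<or> set \<Gamma> \<tturnstile> \<theta>"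
      using disjunction_property less.prems by blast
    then show ?thesis
      by (blast intro: interpolates_left interpolates_swap)
  qed
qed

theorem theorem5p8:
  shows "PDIP (IPC :: 'a fm set) \<and> mPDIP (IPC :: 'a fm set)"
proof -
  have "\<exists>I J. PDI IPC \<phi> \<psi> \<theta> (I, J) \<and> (monotone_fm \<phi> \<longrightarrow> monotone_fm I \<and> monotone_fm J)"
    if "\<phi> \<^bold>\<rightarrow> \<psi> \<^bold>\<or> \<theta> \<in> IPC" for \<phi> \<psi> \<theta> :: "'a fm"
    \<comment> \<open>For a singleton context the bounds on atoms and the monotonicity condition
      speak of \<open>\<phi>\<close> alone.\<close>
    using ex_interpolates[of "[\<phi>]" \<psi> \<theta>] that
    by (auto simp: interpolates_def PDI_def Imp_IPC_iff)
  then show ?thesis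
    unfolding PDIP_def mPDIP_def mPDI_def by fastforce
qed

end
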